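(* Consider the equation for the phase difference $\Psi$ of two-cluster states $$\dot\Psi=\epsilon\,G(\Psi),\qquad G(\Psi)=2\sin\tfrac{\Psi}{2}\Big[A_1\cos\tfrac{\Psi}{2}+B_1\sin\tfrac{\Psi}{2}+A_2\cos\tfrac{3\Psi}{2}+B_2\sin\tfrac{3\Psi}{2}\Big],$$ where $A_1,B_1,A_2,B_2$ depend on $\alpha\in(-1,1)$ and on parameters $R_*$, $\beta_j,\gamma_j$ ($j\in\{-1,2,3,6,7,8,9,10,11\}$) through the formulas given in the context. In the special case of pairwise coupling, $\beta_7=\beta_9=\beta_{11}=0$, and for any $\Psi_0\in(0,2\pi)$, either - $G$ is independent of $\alpha$ and $G(\Psi_0)=0$ for all $\alpha\in(-1,1)$, or - $G(\Psi_0)=0$ for at most one $\alpha\in(-1,1)$. In the more general case where $\beta_7=\beta_9=\beta_{11}=0$ does not hold, there can be an additional case: - $\Psi_0$ is a root of $G(\Psi)=0$ for two distinct $\alpha\in(-1,1)$. Moreover, this case does appear for certain choices of parameters.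
   Context: Background. For $N=Q+P$ identical phase oscillators consider two-cluster states in which $Q$ oscillators share phase $\phi_1$ and $P$ oscillators share phase $\phi_2$; $\Psi=\phi_1-\phi_2$ is the phase difference and $\alpha=(Q-P)/N\in(-1,1)$ measures the relative cluster sizes. $\epsilon$ is the coupling strength and $R_*>0$ is the amplitude of the limit cycle of each uncoupled oscillator. Coefficients. For real $\beta_j,\gamma_j$ (coming from the coupling, not depending on $\alpha$), $$ \begin{aligned} A_1={}&R_*^2\Big(\tfrac{3+\alpha^2}{4}\beta_{11}\sin\gamma_{11}+\tfrac{3-\alpha^2}{4}\beta_7\sin\gamma_7+\tfrac{1+\alpha^2}{2}\beta_9\sin\gamma_9-\beta_2\sin\gamma_2+\sum_{j=3,6,8,10}\beta_j\sin\gamma_j\Big)+\beta_{-1}\sin\gamma_{-1},\\ B_1={}&R_*^2\Big(\tfrac{\alpha+3\alpha^3}{4}\beta_{11}\cos\gamma_{11}+\alpha\sum_{j=2,3,6,7,8,9,10}\beta_j\cos\gamma_j\Big)+\alpha\beta_{-1}\cos\gamma_{-1},\\ A_2={}&R_*^2\Big(\tfrac{1-\alpha^2}{4}\beta_{11}\sin\gamma_{11}+\tfrac{1+\alpha^2}{2}\beta_7\sin\gamma_7+\beta_6\sin\gamma_6\Big),\\ B_2={}&R_*^2\Big(\tfrac{\alpha-\alpha^3}{4}\beta_{11}\cos\gamma_{11}+\alpha(\beta_6\cos\gamma_6+\beta_7\cos\gamma_7)\Big). \end{aligned} $$ The condition $\beta_7=\beta_9=\beta_{11}=0$ corresponds to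 there being only pairwise coupling between the oscillators.
   Formalization: "G is independent of α" is required only of the value G(Ψ₀), since for G as a function of Ψ the claim fails (β₆=1, γ₆=0, other β_j=0, Ψ₀=π); "two distinct α" in the case list means at least two, since three roots can occur, while exactly two is shown to occur. *)

theory Defs
  imports Complex_Main
begin

text \<open>
  The coefficient families are functions on the integers, of which only the indices
  $-1, 2, 3, 6, 7, 8, 9, 10, 11$ are used. \<open>R\<close> is the limit cycle amplitude $R_*$.
\<close>

definition coeff_A1 :: "real \<Rightarrow> (int \<Rightarrow> real) \<Rightarrow> (int \<Rightarrow> real) \<Rightarrow> real \<Rightarrow> real" where
  "coeff_A1 R \<beta> \<gamma> \<alpha> =
     R\<^sup>2 * ((3 + \<alpha>\<^sup>2) / 4 * \<beta> 11 * sin (\<gamma> 11) + (3 - \<alpha>\<^sup>2) / 4 * \<beta> 7 * sin (\<gamma> 7)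
           + (1 + \<alpha>\<^sup>2) / 2 * \<beta> 9 * sin (\<gamma> 9) - \<beta> 2 * sin (\<gamma> 2)
           + (\<Sum>j\<in>{3, 6, 8, 10}. \<beta> j * sin (\<gamma> j)))
     + \<beta> (-1) * sin (\<gamma> (-1))"

definition coeff_B1 :: "real \<Rightarrow> (int \<Rightarrow> real) \<Rightarrow> (int \<Rightarrow> real) \<Rightarrow> real \<Rightarrow> real" where
  "coeff_B1 R \<beta> \<gamma> \<alpha> =
     R\<^sup>2 * ((\<alpha> + 3 * \<alpha>^3) / 4 * \<beta> 11 * cos (\<gamma> 11)
           + \<alpha> * (\<Sum>j\<in>{2, 3, 6, 7, 8, 9, 10}. \<beta> j * cos (\<gamma> j)))
     + \<alpha> * \<beta> (-1) * cos (\<gamma> (-1))"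

definition coeff_A2 :: "real \<Rightarrow> (int \<Rightarrow> real) \<Rightarrow> (int \<Rightarrow> real) \<Rightarrow> real \<Rightarrow> real" where
  "coeff_A2 R \<beta> \<gamma> \<alpha> =
     R\<^sup>2 * ((1 - \<alpha>\<^sup>2) / 4 * \<beta> 11 * sin (\<gamma> 11) + (1 + \<alpha>\<^sup>2) / 2 * \<beta> 7 * sin (\<gamma> 7)
           + \<beta> 6 * sin (\<gamma> 6))"

definition coeff_B2 :: "real \<Rightarrow> (int \<Rightarrow> real) \<Rightarrow> (int \<Rightarrow> real) \<Rightarrow> real \<Rightarrow> real" where
  "coeff_B2 R \<beta> \<gamma> \<alpha> =
     R\<^sup>2 * ((\<alpha> - \<alpha>^3) / 4 * \<beta> 11 * cos (\<gamma> 11)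
           + \<alpha> * (\<beta> 6 * cos (\<gamma> 6) + \<beta> 7 * cos (\<gamma> 7)))"

text \<open>
  The phase difference $\Psi$ of two-cluster states with relative size parameter $\alpha$ obeys
  $\dot\Psi = \epsilon\, G(\Psi)$.
\<close>

definition G :: "real \<Rightarrow> (int \<Rightarrow> real) \<Rightarrow> (int \<Rightarrow> real) \<Rightarrow> real \<Rightarrow> real \<Rightarrow> real" where
  "G R \<beta> \<gamma> \<alpha> \<Psi> =
     2 * sin (\<Psi> / 2) *
       (coeff_A1 R \<beta> \<gamma> \<alpha> * cos (\<Psi> / 2) + coeff_B1 R \<beta> \<gamma> \<alpha> * sin (\<Psi> / 2)
        + coeff_A2 R \<beta> \<gamma> \<alpha> * cos (3 * \<Psi> / 2) + coeff_B2 R \<beta> \<gamma> \<alpha> * sin (3 * \<Psi> / 2))"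

definition pairwise_coupling :: "(int \<Rightarrow> real) \<Rightarrow> bool" where
  "pairwise_coupling \<beta> \<longleftrightarrow> \<beta> 7 = 0 \<and> \<beta> 9 = 0 \<and> \<beta> 11 = 0"

text \<open>
  Independence of $\alpha$ is meant at the given phase difference. It cannot be required of
  $G$ as a function of the phase difference: with pairwise coupling, $\beta_6 = 1$,
  $\gamma_6 = 0$ and all other $\beta_j = 0$, one has $G(\pi) = 0$ for every $\alpha$, while
  $G(\pi/2) = 2 \alpha R_*^2$.
\<close>

definition vanishes_independently :: "real \<Rightarrow> (int \<Rightarrow> real) \<Rightarrow> (int \<Rightarrow> real) \<Rightarrow> real \<Rightarrow> bool" where
  "vanishes_independently R \<beta> \<gamma> \<Psi> \<longleftrightarrow>
     (\<forall>\<alpha>\<in>{-1<..<1}. \<forall>\<alpha>'\<in>{-1<..<1}. G R \<beta> \<gamma> \<alpha> \<Psi> = G R \<beta> \<gamma> \<alpha>' \<Psi>) \<and>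
     (\<forall>\<alpha>\<in>{-1<..<1}. G R \<beta> \<gamma> \<alpha> \<Psi> = 0)"

end

theory Submission
  imports Defs
begin

text \<open>For fixed \<Psi>, \<open>G\<close> is a polynomial in \<alpha> of degree at most 3, and
  the powers above the first come only from the terms with \<open>\<beta> 7\<close>,
  \<open>\<beta> 9\<close> and \<open>\<beta> 11\<close>. Under pairwise coupling \<open>G\<close>
  is therefore affine in \<alpha> (\<open>G_pairwise_affine\<close>), so it is identically zero or
  has at most one root (\<open>affine_roots\<close>). Beyond pairwise coupling a quadratic term can
  survive, and \<open>two_roots\<close> exhibits a parabola with both roots inside the
  interval.\<close>

text \<open>A zero slope makes the function constant; a nonzero slope can be cancelled, which makes
  it injective.\<close>

lemma affine_roots:
  fixes f :: "'a::field \<Rightarrow> 'a"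
  assumes "\<And>x. f x = a + b * x"
  shows "(\<forall>x. f x = 0) \<or> (\<exists>\<^sub>\<le>\<^sub>1x. f x = 0)"
proof (cases "b = 0")
  case True
  then show ?thesis
    using assms by (auto simp: Uniq_def)
next
  case False
  have "x = y" if "f x = 0" "f y = 0" for x y
    using that False assms by (metis add_left_imp_eq mult_left_cancel)
  then show ?thesis
    by (auto intro!: Uniq_I)
qed

text \<open>Once the three higher-order coefficients vanish, \<open>coeff_A1\<close> and
  \<open>coeff_A2\<close> are constant in \<alpha>, while \<open>coeff_B1\<close> and
  \<open>coeff_B2\<close> are multiples of \<alpha>.\<close>

lemma G_pairwise_affine:
  assumes "pairwise_coupling \<beta>"
  obtains a b where "\<And>\<alpha>. G R \<beta> \<gamma> \<alpha> \<Psi> = a + b * \<alpha>"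
proof
  let ?G = "\<lambda>\<alpha>. G R \<beta> \<gamma> \<alpha> \<Psi>"
  \<comment> \<open>Interpolation at 0 and 1 names intercept and slope without writing out the
    trigonometric expressions.\<close>
  show "?G \<alpha> = ?G 0 + (?G 1 - ?G 0) * \<alpha>" for \<alpha>
    using assms
    unfolding pairwise_coupling_def G_def coeff_A1_def coeff_B1_def coeff_A2_def coeff_B2_def
    by (simp add: algebra_simps)
qed

lemma pairwise_roots:
  assumes "pairwise_coupling \<beta>"
  shows "vanishes_independently R \<beta> \<gamma> \<Psi>
         \<or> (\<exists>\<^sub>\<le>\<^sub>1\<alpha>. \<alpha> \<in> {-1<..<1} \<and> G R \<beta> \<gamma> \<alpha> \<Psi> = 0)"
proof -
  obtain a b where "\<And>\<alpha>. G R \<beta> \<gamma> \<alpha> \<Psi> = a + b * \<alpha>"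
    using G_pairwise_affine[OF assms] by blast
  \<comment> \<open>The dichotomy over all reals restricts to the open interval; vanishing
    everywhere yields both halves of \<open>vanishes_independently\<close>.\<close>
  from affine_roots[of "\<lambda>\<alpha>. G R \<beta> \<gamma> \<alpha> \<Psi>", OF this] show ?thesis
    by (auto simp: vanishes_independently_def Uniq_def)
qed

text \<open>With all phases equal to $\pi/2$ the coefficients $B_1, B_2$ vanish, and this choice of
  amplitudes makes $A_2 = 0$ and $A_1 = 2\alpha^2 - 1/2$.\<close>

lemma two_roots:
  defines "\<beta> \<equiv> (\<lambda>_. 0)(2 := 5 / 2, 9 := 4)"
  shows "{\<alpha> \<in> {-1<..<1}. G 1 \<beta> (\<lambda>_. pi / 2) \<alpha> (pi / 2) = 0} = {- (1 / 2), 1 / 2}"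
proof -
  \<comment> \<open>At \<Psi> = pi / 2 the factor 2 sin(pi/4) cos(pi/4) equals 1, so
    \<open>G\<close> is just \<open>coeff_A1\<close>.\<close>
  have eq: "G 1 \<beta> (\<lambda>_. pi / 2) \<alpha> (pi / 2) = 2 * \<alpha>\<^sup>2 - 1 / 2" for \<alpha>
    by (simp add: G_def coeff_A1_def coeff_A2_def coeff_B1_def coeff_B2_def \<beta>_def
        sin_45 cos_45 field_simps)
  have roots: "2 * \<alpha>\<^sup>2 - 1 / 2 = 0 \<longleftrightarrow> \<alpha> = 1 / 2 \<or> \<alpha> = - (1 / 2)" for \<alpha> :: real
    using power2_eq_iff[of \<alpha> "1 / 2"] by (simp add: power_divide) linarith
  show ?thesis
    unfolding eq roots by auto
qed

theorem theorem5p1: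
  "(\<forall>(R::real) (\<beta>::int \<Rightarrow> real) (\<gamma>::int \<Rightarrow> real) (\<Psi>\<^sub>0::real).
      R > 0 \<longrightarrow> pairwise_coupling \<beta> \<longrightarrow> \<Psi>\<^sub>0 \<in> {0<..<2 * pi} \<longrightarrow>
        vanishes_independently R \<beta> \<gamma> \<Psi>\<^sub>0
        \<or> (\<exists>\<^sub>\<le>\<^sub>1\<alpha>. \<alpha> \<in> {-1<..<1} \<and> G R \<beta> \<gamma> \<alpha> \<Psi>\<^sub>0 = 0))
   \<and> (\<forall>(R::real) (\<beta>::int \<Rightarrow> real) (\<gamma>::int \<Rightarrow> real) (\<Psi>\<^sub>0::real).
      R > 0 \<longrightarrow> \<not> pairwise_coupling \<beta> \<longrightarrow> \<Psi>\<^sub>0 \<in> {0<..<2 * pi} \<longrightarrow>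
        vanishes_independently R \<beta> \<gamma> \<Psi>\<^sub>0
        \<or> (\<exists>\<^sub>\<le>\<^sub>1\<alpha>. \<alpha> \<in> {-1<..<1} \<and> G R \<beta> \<gamma> \<alpha> \<Psi>\<^sub>0 = 0)
        \<or> (\<exists>\<alpha>\<^sub>1\<in>{-1<..<1}. \<exists>\<alpha>\<^sub>2\<in>{-1<..<1}.
              \<alpha>\<^sub>1 \<noteq> \<alpha>\<^sub>2 \<and> G R \<beta> \<gamma> \<alpha>\<^sub>1 \<Psi>\<^sub>0 = 0 \<and> G R \<beta> \<gamma> \<alpha>\<^sub>2 \<Psi>\<^sub>0 = 0))
   \<and> (\<exists>(R::real) (\<beta>::int \<Rightarrow> real) (\<gamma>::int \<Rightarrow> real) (\<Psi>\<^sub>0::real).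
      R > 0 \<and> \<not> pairwise_coupling \<beta> \<and> \<Psi>\<^sub>0 \<in> {0<..<2 * pi} \<and>
        card {\<alpha> \<in> {-1<..<1}. G R \<beta> \<gamma> \<alpha> \<Psi>\<^sub>0 = 0} = 2)"
proof (intro conjI allI impI)
  fix R :: real and \<beta> \<gamma> :: "int \<Rightarrow> real" and \<Psi>\<^sub>0 :: real
  assume "pairwise_coupling \<beta>"
  then show "vanishes_independently R \<beta> \<gamma> \<Psi>\<^sub>0
        \<or> (\<exists>\<^sub>\<le>\<^sub>1\<alpha>. \<alpha> \<in> {-1<..<1} \<and> G R \<beta> \<gamma> \<alpha> \<Psi>\<^sub>0 = 0)"
    by (rule pairwise_roots)
next
  fix R :: real and \<beta> \<gamma> :: "int \<Rightarrow> real" and \<Psi>\<^sub>0 :: real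
  show "vanishes_independently R \<beta> \<gamma> \<Psi>\<^sub>0
        \<or> (\<exists>\<^sub>\<le>\<^sub>1\<alpha>. \<alpha> \<in> {-1<..<1} \<and> G R \<beta> \<gamma> \<alpha> \<Psi>\<^sub>0 = 0)
        \<or> (\<exists>\<alpha>\<^sub>1\<in>{-1<..<1}. \<exists>\<alpha>\<^sub>2\<in>{-1<..<1}.
              \<alpha>\<^sub>1 \<noteq> \<alpha>\<^sub>2 \<and> G R \<beta> \<gamma> \<alpha>\<^sub>1 \<Psi>\<^sub>0 = 0 \<and> G R \<beta> \<gamma> \<alpha>\<^sub>2 \<Psi>\<^sub>0 = 0)"
    \<comment> \<open>Pure logic: the failure of uniqueness is the existence of two distinct
      roots.\<close>
    unfolding Uniq_def by blast
next
  \<comment> \<open>The entry at 9 breaks pairwise coupling and supplies the square of \<alpha>; the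
    entry at 2, which enters \<open>coeff_A1\<close> with a minus sign, lowers the parabola so that
    it crosses zero.\<close>
  let ?\<beta> = "(\<lambda>_. 0)(2 := 5 / 2, 9 := 4) :: int \<Rightarrow> real"
  have "\<not> pairwise_coupling ?\<beta>"
    by (simp add: pairwise_coupling_def)
  moreover have "pi / 2 \<in> {0<..<2 * pi}"
    by simp
  moreover have "card {\<alpha> \<in> {-1<..<1}. G 1 ?\<beta> (\<lambda>_. pi / 2) \<alpha> (pi / 2) = 0} = 2"
    unfolding two_roots by simp
  ultimately show "\<exists>(R::real) (\<beta>::int \<Rightarrow> real) (\<gamma>::int \<Rightarrow> real) (\<Psi>\<^sub>0::real).
      R > 0 \<and> \<not> pairwise_coupling \<beta> \<and> \<Psi>\<^sub>0 \<in> {0<..<2 * pi} \<and>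
        card {\<alpha> \<in> {-1<..<1}. G R \<beta> \<gamma> \<alpha> \<Psi>\<^sub>0 = 0} = 2"
    by (intro exI[of _ "1::real"] exI[of _ ?\<beta>] exI[of _ "\<lambda>_. pi / 2"] exI[of _ "pi / 2"]) simp
qed

end
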